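(* Let $G$ be a finite, simple and connected graph with totally ordered vertex set, let $u\in V(G)$, and let $(T_G,u')$ and $\ell_G:V(T_G)\to V(G)$ be the stable-path tree and its labelling map as described in the context. Then there exists a bijection $\varphi_G:\mathcal{P}^{\emptyset}_u(G)\to\mathcal{P}^{\emptyset}_{u'}(T_G)$ such that $|\varphi_G(\mathbf{w})|=|\mathbf{w}|$ for all $\mathbf{w}$ and $\ell_G\circ\pi_{T_G}\circ\varphi_G=\pi_G$ on $\mathcal{P}^{\emptyset}_u(G)$.
   Context: For a finite simple graph $H$, $\mathcal{P}^{\emptyset}(H)$ is the monoid generated by $V(H)$ subject only to $ab=ba$ for distinct non-adjacent $a,b$; its elements are words, $|\mathbf{w}|$ is the length of $\mathbf{w}$, and $\mathcal{P}(H)$ denotes non-empty words. The initial alphabet $\mathrm{IA}(\mathbf{w})$ of a non-empty word is the set of $v$ with $\mathbf{w}=\mathbf{u}v$ for some word $\mathbf{u}$. For $x\in V(H)$, $\mathcal{P}^{\emptyset}_x(H)$ is the set consisting of the empty word together with all non-empty words $\mathbf{w}$ with $\mathrm{IA}(\mathbf{w})\subseteq\{x\}$. $\mathcal{C}^{\emptyset}(H)$ is the free commutative monoid on $V(H)$ and $\pi_H:\mathcal{P}^{\emptyset}(H)\to\mathcal{C}^{\emptyset}(H)$ is the canonical monoid morphism. Stable-path tree: for a finite connected simple graph $G$ with totally ordered vertex set and $u\in V(G)$, with $N_G(u)=\{u_1<\cdots<u_d\}$, define recursively a rooted tree $(T_G,u')$ and a surjective graph homomorphism $\ell_G:V(T_G)\to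 V(G)$ with $\ell_G(u')=u$. If $d=0$ ($G$ is a single vertex), $T_G$ is the single vertex $u'$. If $d\ge1$, for $1\le i\le d$ let $G_i$ be the connected component of $G[V(G)\setminus\{u,u_1,\dots,u_{i-1}\}]$ containing $u_i$, with the induced order, and let $(T_{G_i},u_i')$, $\ell_{G_i}$ be its tree rooted at $u_i$ obtained recursively. Then $T_G$ is the disjoint union of the $T_{G_i}$ together with a new vertex $u'$ joined to $u_1',\dots,u_d'$; $\ell_G(u')=u$ and $\ell_G(x)=\ell_{G_i}(x)$ for $x\in V(T_{G_i})$. The map $\ell_G$ is extended to a monoid morphism $\mathcal{C}^{\emptyset}(T_G)\to\mathcal{C}^{\emptyset}(G)$. *)

theory Defs
  imports
    "HOL-Algebra.Group"
    "HOL-Library.Multiset"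
    "Graph_Theory.Graph_Theory"
begin

text \<open>A finite simple graph is a \<^locale>\<open>pair_graph\<close>: a finite loop-free digraph whose arc set
  \<^term>\<open>parcs H\<close> is symmetric, an edge being represented by its two orientations.\<close>

section \<open>The partially commutative monoid of a graph\<close>

text \<open>The least monoid congruence on the words over \<open>V(H)\<close> that identifies \<open>ab\<close> and \<open>ba\<close>
  for distinct non-adjacent \<open>a\<close>, \<open>b\<close>.\<close>

inductive_set word_cong :: "'a pair_pre_digraph \<Rightarrow> 'a list rel"
  for H :: "'a pair_pre_digraph" where
  swap: "\<lbrakk>a \<in> pverts H; b \<in> pverts H; a \<noteq> b; (a, b) \<notin> parcs H\<rbrakk>
    \<Longrightarrow> ([a, b], [b, a]) \<in> word_cong H"
| refl: "xs \<in> lists (pverts H) \<Longrightarrow> (xs, xs) \<in> word_cong H"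
| sym: "(xs, ys) \<in> word_cong H \<Longrightarrow> (ys, xs) \<in> word_cong H"
| trans: "\<lbrakk>(xs, ys) \<in> word_cong H; (ys, zs) \<in> word_cong H\<rbrakk> \<Longrightarrow> (xs, zs) \<in> word_cong H"
| append: "\<lbrakk>(xs, ys) \<in> word_cong H; (xs', ys') \<in> word_cong H\<rbrakk>
    \<Longrightarrow> (xs @ xs', ys @ ys') \<in> word_cong H"

definition word_class :: "'a pair_pre_digraph \<Rightarrow> 'a list \<Rightarrow> 'a list set" where
  "word_class H xs = word_cong H `` {xs}"

definition word_monoid :: "'a pair_pre_digraph \<Rightarrow> 'a list set monoid" where
  "word_monoid H =
    \<lparr>carrier = lists (pverts H) // word_cong H,
     monoid.mult = (\<lambda>w z. \<Union>xs\<in>w. \<Union>ys\<in>z. word_class H (xs @ ys)),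
     one = word_class H []\<rparr>"

definition free_comm_monoid :: "'a set \<Rightarrow> 'a multiset monoid" where
  "free_comm_monoid A = \<lparr>carrier = {M. set_mset M \<subseteq> A}, monoid.mult = (+), one = {#}\<rparr>"

text \<open>Congruent lists have the same length and the same multiset of letters (\<open>word_cong_mset\<close>
  below), so both images under \<^const>\<open>the_elem\<close> are singletons.\<close>

definition word_length :: "'a list set \<Rightarrow> nat" where
  "word_length w = the_elem (length ` w)"

definition word_comm :: "'a list set \<Rightarrow> 'a multiset" where
  "word_comm w = the_elem (mset ` w)"

text \<open>The initial alphabet consists of the possible \<^emph>\<open>last\<close> letters of \<open>w\<close>.\<close>

definition initial_alphabet :: "'a pair_pre_digraph \<Rightarrow> 'a list set \<Rightarrow> 'a set" where
  "initial_alphabet H w =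
    {v \<in> pverts H. \<exists>z \<in> carrier (word_monoid H). w = z \<otimes>\<^bsub>word_monoid H\<^esub> word_class H [v]}"

definition words_at :: "'a pair_pre_digraph \<Rightarrow> 'a \<Rightarrow> 'a list set set" where
  "words_at H x = {\<one>\<^bsub>word_monoid H\<^esub>} \<union>
    {w \<in> carrier (word_monoid H). w \<noteq> \<one>\<^bsub>word_monoid H\<^esub> \<and> initial_alphabet H w \<subseteq> {x}}"

lemma word_cong_mset: "(xs, ys) \<in> word_cong H \<Longrightarrow> mset xs = mset ys"
  by (induction rule: word_cong.induct) auto

lemma word_cong_lists:
  "(xs, ys) \<in> word_cong H \<Longrightarrow> xs \<in> lists (pverts H) \<and> ys \<in> lists (pverts H)"
  by (induction rule: word_cong.induct) auto

lemma equiv_word_cong: "equiv (lists (pverts H)) (word_cong H)"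
  by (rule equivI)
    (auto simp: refl_on_def sym_def trans_def
      intro: word_cong.refl word_cong.sym word_cong.trans dest: word_cong_lists)

lemma word_comm_class: "xs \<in> lists (pverts H) \<Longrightarrow> word_comm (word_class H xs) = mset xs"
proof -
  assume "xs \<in> lists (pverts H)"
  then have "mset ` word_class H xs = {mset xs}"
    unfolding word_class_def by (force dest: word_cong_mset intro: word_cong.refl)
  then show ?thesis by (simp add: word_comm_def)
qed

lemma word_length_class: "xs \<in> lists (pverts H) \<Longrightarrow> word_length (word_class H xs) = length xs"
proof -
  assume "xs \<in> lists (pverts H)"
  then have "length ` word_class H xs = {length xs}"
    unfolding word_class_def by (force dest: word_cong_mset mset_eq_length intro: word_cong.refl)
  then show ?thesis by (simp add: word_length_def)
qed

lemma word_class_eq: "(xs, ys) \<in> word_cong H \<Longrightarrow> word_class H xs = word_class H ys"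
  unfolding word_class_def by (rule equiv_class_eq[OF equiv_word_cong])

lemma word_monoid_carrier: "carrier (word_monoid H) = word_class H ` lists (pverts H)"
  by (auto simp: word_monoid_def quotient_def word_class_def)

lemma word_monoid_one: "\<one>\<^bsub>word_monoid H\<^esub> = word_class H []"
  by (simp add: word_monoid_def)

lemma word_monoid_mult:
  assumes "xs \<in> lists (pverts H)" "ys \<in> lists (pverts H)"
  shows "word_class H xs \<otimes>\<^bsub>word_monoid H\<^esub> word_class H ys = word_class H (xs @ ys)"
proof -
  have same: "word_class H (xs' @ ys') = word_class H (xs @ ys)"
    if "xs' \<in> word_class H xs" "ys' \<in> word_class H ys" for xs' ys'
    using that by (metis Image_singleton_iff word_class_def word_class_eq word_cong.append)
  have nonempty: "word_class H xs \<noteq> {}" "word_class H ys \<noteq> {}"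
    using assms by (auto simp: word_class_def intro: word_cong.refl)
  have "(\<Union>xs'\<in>word_class H xs. \<Union>ys'\<in>word_class H ys. word_class H (xs' @ ys')) =
      (\<Union>xs'\<in>word_class H xs. \<Union>ys'\<in>word_class H ys. word_class H (xs @ ys))"
    by (intro SUP_cong HOL.refl same)
  then show ?thesis by (simp add: word_monoid_def nonempty)
qed

lemma monoid_word_monoid: "monoid (word_monoid H)"
proof (rule monoidI; (unfold word_monoid_carrier word_monoid_one)?; (elim imageE)?)
  fix x y xs ys
  assume "xs \<in> lists (pverts H)" "ys \<in> lists (pverts H)"
    "x = word_class H xs" "y = word_class H ys"
  then show "x \<otimes>\<^bsub>word_monoid H\<^esub> y \<in> word_class H ` lists (pverts H)"
    by (metis append_in_lists_conv image_eqI word_monoid_mult)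
next
  show "word_class H [] \<in> word_class H ` lists (pverts H)" by blast
next
  fix x y z xs ys zs
  assume "xs \<in> lists (pverts H)" "ys \<in> lists (pverts H)" "zs \<in> lists (pverts H)"
    "x = word_class H xs" "y = word_class H ys" "z = word_class H zs"
  then show "x \<otimes>\<^bsub>word_monoid H\<^esub> y \<otimes>\<^bsub>word_monoid H\<^esub> z = x \<otimes>\<^bsub>word_monoid H\<^esub> (y \<otimes>\<^bsub>word_monoid H\<^esub> z)"
    by (metis append_assoc append_in_lists_conv word_monoid_mult)
next
  fix x xs
  assume "xs \<in> lists (pverts H)" "x = word_class H xs"
  then show "word_class H [] \<otimes>\<^bsub>word_monoid H\<^esub> x = x"
    by (metis append_Nil lists.Nil word_monoid_mult)
next
  fix x xs
  assume "xs \<in> lists (pverts H)" "x = word_class H xs"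
  then show "x \<otimes>\<^bsub>word_monoid H\<^esub> word_class H [] = x"
    by (metis append_Nil2 lists.Nil word_monoid_mult)
qed

lemma word_comm_hom: "word_comm \<in> hom (word_monoid H) (free_comm_monoid (pverts H))"
proof (rule homI; unfold word_monoid_carrier; elim imageE)
  fix x xs
  assume "xs \<in> lists (pverts H)" "x = word_class H xs"
  then show "word_comm x \<in> carrier (free_comm_monoid (pverts H))"
    by (auto simp: word_comm_class free_comm_monoid_def)
next
  fix x y xs ys
  assume "xs \<in> lists (pverts H)" "ys \<in> lists (pverts H)"
    "x = word_class H xs" "y = word_class H ys"
  then show "word_comm (x \<otimes>\<^bsub>word_monoid H\<^esub> y) =
      word_comm x \<otimes>\<^bsub>free_comm_monoid (pverts H)\<^esub> word_comm y"
    using word_comm_class[of "xs @ ys" H]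
    by (simp add: word_comm_class word_monoid_mult free_comm_monoid_def)
qed

section \<open>The stable-path tree\<close>

definition pair_induce :: "'a pair_pre_digraph \<Rightarrow> 'a set \<Rightarrow> 'a pair_pre_digraph" where
  "pair_induce G S = \<lparr>pverts = S, parcs = {(a, b) \<in> parcs G. a \<in> S \<and> b \<in> S}\<rparr>"

lemma with_proj_pair_induce: "with_proj (pair_induce G S) = with_proj G \<restriction> S"
  by (auto simp: pair_induce_def with_proj_def induce_subgraph_def)

text \<open>The connected components of a symmetric digraph are its strongly connected components.\<close>

definition component_at :: "'a pair_pre_digraph \<Rightarrow> 'a \<Rightarrow> 'a pair_pre_digraph" where
  "component_at G x = pair_induce G (pre_digraph.scc_of (with_proj G) x)"

definition neighbours :: "'a pair_pre_digraph \<Rightarrow> 'a \<Rightarrow> 'a set" where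
  "neighbours G u = {v. (u, v) \<in> parcs G}"

text \<open>For the \<open>i\<close>-th neighbour \<open>x = u\<^sub>i\<close> of \<open>u\<close>, this is the graph \<open>G\<^sub>i\<close>: the vertices
  \<open>u\<^sub>1, \<dots>, u\<^sub>i\<^sub>-\<^sub>1\<close> are the neighbours of \<open>u\<close> smaller than \<open>x\<close>.\<close>

definition branch :: "'a::linorder pair_pre_digraph \<Rightarrow> 'a \<Rightarrow> 'a \<Rightarrow> 'a pair_pre_digraph" where
  "branch G u x =
    component_at (pair_induce G (pverts G - ({u} \<union> {y \<in> neighbours G u. y < x}))) x"

lemma pverts_branch_subset: "pverts (branch G u x) \<subseteq> pverts G - {u}"
  by (auto simp: branch_def component_at_def pair_induce_def pre_digraph.scc_of_def
      reachable_def dest: in_rtrancl_on_in_F)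

lemma card_branch_less:
  assumes "finite (pverts G)" "u \<in> pverts G"
  shows "card (pverts (branch G u x)) < card (pverts G)"
  using assms pverts_branch_subset[of G u x] by (intro psubset_card_mono) auto

lemma pair_graph_pair_induce:
  assumes "pair_graph G" "S \<subseteq> pverts G"
  shows "pair_graph (pair_induce G S)"
proof -
  interpret pair_graph G by fact
  have "parcs (pair_induce G S) \<subseteq> parcs G"
    by (auto simp: pair_induce_def)
  then have "finite (parcs (pair_induce G S))"
    using pair_finite_arcs finite_subset by blast
  moreover have "finite (pverts (pair_induce G S))"
    using finite_subset[OF assms(2) pair_finite_verts] by (simp add: pair_induce_def)
  moreover have "symmetric (with_proj (pair_induce G S))"
    using arcs_symmetric by (auto simp: symmetric_def pair_induce_def intro!: symI)
  ultimately show ?thesis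
    by unfold_locales (auto simp: pair_induce_def dest: no_loops')
qed

lemma branch_props:
  assumes "pair_graph G" "x \<in> neighbours G u"
  shows "pair_graph (branch G u x)" and "x \<in> pverts (branch G u x)"
proof -
  interpret pair_graph G by fact
  let ?S = "pverts G - ({u} \<union> {y \<in> neighbours G u. y < x})"
  have "x \<in> ?S"
    using assms(2) by (auto simp: neighbours_def dest: in_arcsD2 no_loops')
  then show "x \<in> pverts (branch G u x)"
    by (auto simp: branch_def component_at_def pair_induce_def pre_digraph.scc_of_def reachable_def)
  have "pair_graph (pair_induce G ?S)"
    by (rule pair_graph_pair_induce[OF assms(1)]) auto
  moreover have "pre_digraph.scc_of (with_proj (pair_induce G ?S)) x \<subseteq> pverts (pair_induce G ?S)"
    by (auto simp: pre_digraph.scc_of_def reachable_def dest: in_rtrancl_on_in_F)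
  ultimately show "pair_graph (branch G u x)"
    unfolding branch_def component_at_def by (rule pair_graph_pair_induce)
qed

text \<open>The root of the tree of \<open>(G, u)\<close> is \<open>[u]\<close>. The disjoint union of the trees of the branches
  is realised by putting \<open>u\<close> in front of their vertices: every vertex of the tree of
  \<open>(branch G u x, x)\<close> is a list starting with \<open>x\<close>, so the copies for different neighbours \<open>x\<close>
  are disjoint from each other and from the root. The root \<open>[x]\<close> of a branch becomes \<open>[u, x]\<close>.
  The test in the definition only makes the function total: by \<open>branch_props\<close> it holds in all
  recursive calls when \<open>G\<close> is a finite simple graph with vertex \<open>u\<close>.\<close>

function stable_path_tree :: "'a::linorder pair_pre_digraph \<Rightarrow> 'a \<Rightarrow> 'a list pair_pre_digraph" where
  "stable_path_tree G u =
    (if finite (pverts G) \<and> u \<in> pverts G then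
      \<lparr>pverts = {[u]} \<union> (\<Union>x \<in> neighbours G u. Cons u ` pverts (stable_path_tree (branch G u x) x)),
       parcs = (\<Union>x \<in> neighbours G u. {([u], [u, x]), ([u, x], [u])} \<union>
         map_prod (Cons u) (Cons u) ` parcs (stable_path_tree (branch G u x) x))\<rparr>
     else \<lparr>pverts = {[u]}, parcs = {}\<rparr>)"
  by pat_completeness auto
termination
  by (relation "measure (\<lambda>(G, u). card (pverts G))") (auto intro: card_branch_less)

declare stable_path_tree.simps [simp del]

text \<open>The recursion \<open>\<ell>\<^sub>G(u') = u\<close> and \<open>\<ell>\<^sub>G(x) = \<ell>\<^sub>G\<^sub>i(x)\<close> on the \<open>i\<close>-th branch says that
  a list is labelled by its last entry; see \<open>tree_label_root\<close> and \<open>tree_label_branch\<close>.\<close>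

definition tree_root :: "'a \<Rightarrow> 'a list" where
  "tree_root u = [u]"

definition tree_label :: "'a list \<Rightarrow> 'a" where
  "tree_label p = last p"

lemma hd_stable_path_tree: "p \<in> pverts (stable_path_tree G u) \<Longrightarrow> p \<noteq> [] \<and> hd p = u"
  by (subst (asm) stable_path_tree.simps) (auto split: if_splits)

lemma root_in_stable_path_tree: "[u] \<in> pverts (stable_path_tree G u)"
  by (subst stable_path_tree.simps) auto

lemma pair_graph_stable_path_tree:
  "pair_graph G \<Longrightarrow> pair_graph (stable_path_tree G u)"
proof (induction G u rule: stable_path_tree.induct)
  case (1 G u)
  interpret pair_graph G by fact
  show ?case
  proof (cases "u \<in> pverts G")
    case True
    let ?T = "\<lambda>x. stable_path_tree (branch G u x) x"
    have T: "stable_path_tree G u =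
      \<lparr>pverts = {[u]} \<union> (\<Union>x \<in> neighbours G u. Cons u ` pverts (?T x)),
       parcs = (\<Union>x \<in> neighbours G u. {([u], [u, x]), ([u, x], [u])} \<union>
         map_prod (Cons u) (Cons u) ` parcs (?T x))\<rparr>"
      using True pair_finite_verts by (subst stable_path_tree.simps) simp
    have fin: "finite (neighbours G u)"
      by (rule finite_subset[OF _ pair_finite_verts]) (auto simp: neighbours_def dest: in_arcsD2)
    have IH: "pair_graph (?T x)" if "x \<in> neighbours G u" for x
      using "1.IH"[of x] True pair_finite_verts that branch_props(1)[OF "1.prems"] by auto
    note Tx = IH[unfolded pair_graph_def pair_digraph_def pair_fin_digraph_def
        pair_fin_digraph_axioms_def pair_loopfree_digraph_def pair_loopfree_digraph_axioms_def
        pair_wf_digraph_def]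
    have symT: "(q, p) \<in> parcs (?T x)" if "x \<in> neighbours G u" "(p, q) \<in> parcs (?T x)" for x p q
      using IH[OF that(1)] that(2)
      by (meson pair_graph_def pair_pseudo_graph_def pair_sym_digraph.arcs_symmetric)
    show ?thesis
    proof unfold_locales
      show "finite (pverts (stable_path_tree G u))" "finite (parcs (stable_path_tree G u))"
        using fin Tx by (auto simp: T)
      show "fst e \<in> pverts (stable_path_tree G u)" "snd e \<in> pverts (stable_path_tree G u)"
        if "e \<in> parcs (stable_path_tree G u)" for e
        using that Tx root_in_stable_path_tree by (fastforce simp: T)+
      show "fst e \<noteq> snd e" if "e \<in> parcs (stable_path_tree G u)" for e
        using that Tx by (fastforce simp: T)
      show "symmetric (with_proj (stable_path_tree G u))"
        using symT by (fastforce simp: T symmetric_def intro!: symI)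
    qed
  next
    case False
    then have "stable_path_tree G u = \<lparr>pverts = {[u]}, parcs = {}\<rparr>"
      by (subst stable_path_tree.simps) simp
    then show ?thesis
      by unfold_locales (auto simp: symmetric_def sym_def)
  qed
qed

lemma tree_label_root: "tree_label (tree_root u) = u"
  by (simp add: tree_label_def tree_root_def)

lemma tree_label_branch:
  "p \<in> pverts (stable_path_tree (branch G u x) x) \<Longrightarrow> tree_label (u # p) = tree_label p"
  by (auto simp: tree_label_def dest: hd_stable_path_tree)

end

theory Submission
  imports Defs
begin

text \<open>View a word as a heap of pieces, the last letter on top. Every word splits uniquely into
  the pieces below an occurrence of a letter of \<open>X\<close> (a word with initial alphabet inside \<open>X\<close>)
  followed by a word without letters in \<open>X\<close>. For \<open>X = {u}\<close>, after stripping the final \<open>u\<close>, this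
  exhibits the words at \<open>u\<close> as the free monoid on the \<open>w u\<close>, where \<open>w\<close> avoids \<open>u\<close> and has
  initial alphabet inside \<open>N(u)\<close>. Splitting such a \<open>w\<close> at the neighbours
  \<open>u\<^sub>1 < \<dots> < u\<^sub>d\<close> in turn makes it a product of words at \<open>u\<^sub>i\<close> in \<open>G\<^sub>i\<close>.
  The tree decomposes in the same way into the trees of the \<open>G\<^sub>i\<close>, so induction applies. Only the
  weights in the free commutative monoid need to be tracked, as they determine the length.\<close>

section \<open>Weight-preserving bijections\<close>

text \<open>The bijection is hidden in an existential so that decompositions can be chained,
  multiplied and inverted like identities of generating functions.\<close>

definition weight_equiv :: "'a set \<Rightarrow> ('a \<Rightarrow> 'c) \<Rightarrow> 'b set \<Rightarrow> ('b \<Rightarrow> 'c) \<Rightarrow> bool" where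
  "weight_equiv A f B g \<longleftrightarrow> (\<exists>\<phi>. bij_betw \<phi> A B \<and> (\<forall>a\<in>A. g (\<phi> a) = f a))"

lemma weight_equiv_sym: "weight_equiv A f B g \<Longrightarrow> weight_equiv B g A f"
  unfolding weight_equiv_def
proof (elim exE conjE)
  fix \<phi> assume b: "bij_betw \<phi> A B" and w: "\<forall>a\<in>A. g (\<phi> a) = f a"
  have "f (inv_into A \<phi> x) = g x" if "x \<in> B" for x
    using b w that by (metis bij_betw_def f_inv_into_f inv_into_into)
  then show "\<exists>\<psi>. bij_betw \<psi> B A \<and> (\<forall>x\<in>B. f (\<psi> x) = g x)"
    using bij_betw_inv_into[OF b] by blast
qed

lemma weight_equiv_trans:
  "weight_equiv A f B g \<Longrightarrow> weight_equiv B g C h \<Longrightarrow> weight_equiv A f C h"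
  unfolding weight_equiv_def
proof (elim exE conjE)
  fix \<phi> \<psi>
  assume "bij_betw \<phi> A B" "\<forall>a\<in>A. g (\<phi> a) = f a" "bij_betw \<psi> B C" "\<forall>b\<in>B. h (\<psi> b) = g b"
  then show "\<exists>\<chi>. bij_betw \<chi> A C \<and> (\<forall>a\<in>A. h (\<chi> a) = f a)"
    by (intro exI[of _ "\<psi> \<circ> \<phi>"]) (auto dest: bij_betwE intro: bij_betw_trans)
qed

lemma weight_equiv_map:
  "weight_equiv A f B g \<Longrightarrow> weight_equiv A (\<lambda>a. k (f a)) B (\<lambda>b. k (g b))"
  unfolding weight_equiv_def by metis

lemma weight_equiv_cong:
  "(\<And>a. a \<in> A \<Longrightarrow> f a = f' a) \<Longrightarrow> (\<And>b. b \<in> B \<Longrightarrow> g b = g' b) \<Longrightarrow>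
    weight_equiv A f B g \<Longrightarrow> weight_equiv A f' B g'"
  unfolding weight_equiv_def by (metis bij_betwE)

text \<open>Two maps on \<open>L\<close> with the same fibres have images in canonical bijection. In
  the applications \<open>L\<close> consists of lists or pairs of lists, and \<open>p\<close>,
  \<open>q\<close> are two ways of forming classes from them.\<close>

lemma weight_equiv_image:
  assumes "\<And>x. x \<in> L \<Longrightarrow> f (p x) = g (q x)"
    and eq: "\<And>x y. x \<in> L \<Longrightarrow> y \<in> L \<Longrightarrow> p x = p y \<longleftrightarrow> q x = q y"
  shows "weight_equiv (p ` L) f (q ` L) g"
proof -
  let ?r = "inv_into L p"
  have r: "?r (p x) \<in> L" "q (?r (p x)) = q x" if "x \<in> L" for x
    using that eq[of "?r (p x)" x] by (auto simp: inv_into_into f_inv_into_f)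
  have "bij_betw (\<lambda>a. q (?r a)) (p ` L) (q ` L)"
    using r eq by (auto simp: bij_betw_def inj_on_def image_image)
  moreover have "\<forall>a\<in>p ` L. g (q (?r a)) = f a"
    using r assms(1) by auto
  ultimately show ?thesis
    unfolding weight_equiv_def by blast
qed

lemma weight_equiv_prod:
  assumes "weight_equiv A f B g" "weight_equiv A' f' B' g'"
  shows "weight_equiv (A \<times> A') (\<lambda>(a, a'). f a + f' a') (B \<times> B') (\<lambda>(b, b'). g b + g' b')"
proof -
  obtain \<phi> \<psi> where *: "bij_betw \<phi> A B" "\<forall>a\<in>A. g (\<phi> a) = f a"
    "bij_betw \<psi> A' B'" "\<forall>a\<in>A'. g' (\<psi> a) = f' a"
    using assms unfolding weight_equiv_def by blast
  then show ?thesis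
    unfolding weight_equiv_def
    by (intro exI[of _ "map_prod \<phi> \<psi>"]) (auto intro: bij_betw_map_prod)
qed

lemma weight_equiv_lists:
  assumes "weight_equiv A f B g"
  shows "weight_equiv (lists A) (\<lambda>l. sum_list (map f l)) (lists B) (\<lambda>l. sum_list (map g l))"
proof -
  obtain \<phi> where *: "bij_betw \<phi> A B" "\<forall>a\<in>A. g (\<phi> a) = f a"
    using assms unfolding weight_equiv_def by blast
  have "sum_list (map g (map \<phi> l)) = sum_list (map f l)" if "l \<in> lists A" for l
    using that *(2) by (induction l) auto
  then show ?thesis
    using bij_lists[OF *(1)] unfolding weight_equiv_def by blast
qed

text \<open>The recursion \<open>A = 1 + A Q\<close> makes \<open>A\<close> a free monoid on \<open>Q\<close>; as \<open>g\<close> never vanishes on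
  \<open>Q\<close>, unfolding it terminates.\<close>

lemma weight_equiv_star:
  fixes f :: "'a \<Rightarrow> 'c multiset" and g :: "'q \<Rightarrow> 'c multiset"
  assumes rec: "weight_equiv (A \<times> Q) (\<lambda>(a, q). f a + g q) (A - {e}) f"
    and e: "e \<in> A" "f e = {#}" and pos: "\<And>q. q \<in> Q \<Longrightarrow> g q \<noteq> {#}"
  shows "weight_equiv (lists Q) (\<lambda>l. sum_list (map g l)) A f"
proof -
  obtain c where c: "bij_betw c (A \<times> Q) (A - {e})"
    and wt: "\<And>a q. a \<in> A \<Longrightarrow> q \<in> Q \<Longrightarrow> f (c (a, q)) = f a + g q"
    using rec unfolding weight_equiv_def by fastforce
  have c_in: "c (a, q) \<in> A" "c (a, q) \<noteq> e" if "a \<in> A" "q \<in> Q" for a q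
    using bij_betwE[OF c] that by auto
  have c_inj: "a = a' \<and> q = q'" if "c (a, q) = c (a', q')" "a \<in> A" "q \<in> Q" "a' \<in> A" "q' \<in> Q"
    for a q a' q'
    using inj_onD[OF bij_betw_imp_inj_on[OF c] that(1)] that by auto
  \<comment> \<open>\<open>F l e\<close> is the product coded by \<open>l\<close>, built up from the
    unit \<open>e\<close>. The head of \<open>l\<close> is the factor applied last, so injectivity
    can peel off heads.\<close>
  define F where "F = foldr (\<lambda>q a. c (a, q))"
  have F: "F l e \<in> A \<and> f (F l e) = sum_list (map g l)" if "l \<in> lists Q" for l
    using that by (induction l) (auto simp: F_def e wt c_in add.commute)
  have inj: "l = l'" if "F l e = F l' e" "l \<in> lists Q" "l' \<in> lists Q" for l l'
    using that
  proof (induction l arbitrary: l')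
    case Nil
    then show ?case
    proof (cases l')
      case (Cons q m)
      then have "q \<in> Q" "F m e \<in> A" "c (F m e, q) = e"
        using Nil F by (auto simp: F_def)
      then show ?thesis using c_in by blast
    qed simp
  next
    case (Cons q l)
    from Cons.prems have l: "q \<in> Q" "l \<in> lists Q" by auto
    show ?case
    proof (cases l')
      case Nil
      then have "c (F l e, q) = e" using Cons.prems by (simp add: F_def)
      then show ?thesis using c_in F l by blast
    next
      case (Cons q' m)
      with Cons.prems have m: "q' \<in> Q" "m \<in> lists Q" and eq: "c (F l e, q) = c (F m e, q')"
        by (auto simp: F_def)
      have "F l e = F m e \<and> q = q'"
        by (rule c_inj[OF eq]) (use F l m in auto)
      then show ?thesis using Cons.IH[OF _ l(2) m(2)] Cons by simp
    qed
  qed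
  have surj: "\<exists>l\<in>lists Q. F l e = a" if "a \<in> A" for a
    using that
  proof (induction "size (f a)" arbitrary: a rule: less_induct)
    case less
    show ?case
    proof (cases "a = e")
      case True
      then show ?thesis by (intro bexI[of _ "[]"]) (auto simp: F_def)
    next
      case False
      then have "a \<in> c ` (A \<times> Q)"
        using bij_betw_imp_surj_on[OF c] less.prems by simp
      then obtain b q where b: "b \<in> A" "q \<in> Q" "a = c (b, q)"
        by auto
      have "size (f b) < size (f a)"
        using b pos[OF b(2)] by (simp add: wt nonempty_has_size)
      then obtain l where "l \<in> lists Q" "F l e = b"
        using less.hyps b(1) by blast
      then show ?thesis
        using b by (intro bexI[of _ "q # l"]) (auto simp: F_def)
    qed
  qed
  have "bij_betw (\<lambda>l. F l e) (lists Q) A"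
  proof (rule bij_betw_imageI)
    show "inj_on (\<lambda>l. F l e) (lists Q)"
      by (rule inj_onI) (rule inj)
    show "(\<lambda>l. F l e) ` lists Q = A"
    proof (rule subset_antisym)
      show "(\<lambda>l. F l e) ` lists Q \<subseteq> A"
        using F by (intro image_subsetI) simp
      show "A \<subseteq> (\<lambda>l. F l e) ` lists Q"
        using surj by (intro subsetI) (metis image_eqI)
    qed
  qed
  then show ?thesis
    using F unfolding weight_equiv_def by blast
qed

section \<open>Words up to commutation\<close>

text \<open>This is the dependence relation of trace theory; it is reflexive because two occurrences
  of one letter never change their order.\<close>

definition linked :: "'a pair_pre_digraph \<Rightarrow> 'a \<Rightarrow> 'a \<Rightarrow> bool" where
  "linked H a b \<longleftrightarrow> a = b \<or> (a, b) \<in> parcs H"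

lemma linked_commute: "sym (parcs H) \<Longrightarrow> linked H a b \<longleftrightarrow> linked H b a"
  by (auto simp: linked_def dest: symD)

lemma word_class_eq_iff:
  "xs \<in> lists (pverts H) \<Longrightarrow> word_class H xs = word_class H ys \<longleftrightarrow> (xs, ys) \<in> word_cong H"
  using word_class_eq word_cong.refl word_cong.sym
  by (metis Image_singleton_iff word_class_def)

lemma word_cong_set: "(xs, ys) \<in> word_cong H \<Longrightarrow> set xs = set ys"
  by (metis set_mset_mset word_cong_mset)

lemma word_cong_Cons:
  "a \<in> pverts H \<Longrightarrow> (xs, ys) \<in> word_cong H \<Longrightarrow> (a # xs, a # ys) \<in> word_cong H"
  using word_cong.append[of "[a]" "[a]"] word_cong.refl[of "[a]"] by simp

text \<open>A single swap in context replaces closure under concatenation, with which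
  \<open>remove1\<close> and \<open>lower\<close> are awkward to combine.\<close>

lemma word_cong_swap_induct [consumes 1, case_names refl sym trans swap]:
  assumes "(xs, ys) \<in> word_cong H"
    and refl: "\<And>xs. xs \<in> lists (pverts H) \<Longrightarrow> P xs xs"
    and sym: "\<And>xs ys. P xs ys \<Longrightarrow> P ys xs"
    and trans: "\<And>xs ys zs. P xs ys \<Longrightarrow> P ys zs \<Longrightarrow> P xs zs"
    and swap: "\<And>a b l r. a \<in> pverts H \<Longrightarrow> b \<in> pverts H \<Longrightarrow> \<not> linked H a b \<Longrightarrow>
      l \<in> lists (pverts H) \<Longrightarrow> r \<in> lists (pverts H) \<Longrightarrow> P (l @ a # b # r) (l @ b # a # r)"
  shows "P xs ys"
proof -
  \<comment> \<open>Quantifying over all contexts handles \<open>append\<close>: first the left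
    factor is changed, then the right one.\<close>
  have "P (l @ xs @ r) (l @ ys @ r)" if "l \<in> lists (pverts H)" "r \<in> lists (pverts H)" for l r
    using assms(1) that
  proof (induction arbitrary: l r rule: word_cong.induct)
    case (append xs ys xs' ys')
    have in_lists: "xs' \<in> lists (pverts H)" "ys \<in> lists (pverts H)"
      using append.hyps by (auto dest: word_cong_lists)
    have "P (l @ xs @ (xs' @ r)) (l @ ys @ (xs' @ r))"
      using append.IH(1)[of l "xs' @ r"] append.prems in_lists by simp
    moreover have "P ((l @ ys) @ xs' @ r) ((l @ ys) @ ys' @ r)"
      using append.IH(2)[of "l @ ys" r] append.prems in_lists by simp
    ultimately show ?case using trans by fastforce
  next
    case (trans xs ys zs)
    then show ?case using assms(4) by blast
  qed (use refl sym swap in \<open>auto simp: linked_def\<close>)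
  from this[of "[]" "[]"] show ?thesis by simp
qed

text \<open>Only letters in \<open>S\<close> are constrained, so the lemma also applies to the
  inverse of an embedding, which is controlled on the image alone.\<close>

lemma word_cong_map:
  assumes "(xs, ys) \<in> word_cong H" "set xs \<subseteq> S" "f ` S \<subseteq> pverts K"
    and "\<And>a b. a \<in> S \<Longrightarrow> b \<in> S \<Longrightarrow> \<not> linked H a b \<Longrightarrow> \<not> linked K (f a) (f b)"
  shows "(map f xs, map f ys) \<in> word_cong K"
  using assms(1,2)
proof (induction rule: word_cong.induct)
  case (swap a b)
  then show ?case
    using assms(3) assms(4)[of a b] by (auto simp: linked_def intro!: word_cong.swap)
next
  case (refl xs)
  then have "map f xs \<in> lists (pverts K)"
    using assms(3) by fastforce
  then show ?case by (rule word_cong.refl)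
next
  case (sym xs ys)
  then show ?case using word_cong_set word_cong.sym by metis
next
  case (trans xs ys zs)
  then show ?case using word_cong_set word_cong.trans by metis
next
  case (append xs ys xs' ys')
  then show ?case by (auto intro: word_cong.append)
qed

lemma word_cong_rev: "(xs, ys) \<in> word_cong H \<Longrightarrow> (rev xs, rev ys) \<in> word_cong H"
proof (induction rule: word_cong.induct)
  case (swap a b)
  then show ?case using word_cong.swap[THEN word_cong.sym] by fastforce
next
  case (sym xs ys)
  then show ?case by (simp add: word_cong.sym)
next
  case (trans xs ys zs)
  then show ?case using word_cong.trans by blast
qed (auto intro: word_cong.refl word_cong.append)

text \<open>Equal letters never pass each other, so the first occurrences of \<open>c\<close> in
  congruent words correspond and can be deleted together.\<close>

lemma word_cong_remove1:
  assumes "(xs, ys) \<in> word_cong H"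
  shows "(remove1 c xs, remove1 c ys) \<in> word_cong H"
  using assms
proof (induction rule: word_cong_swap_induct)
  case (refl xs)
  then show ?case
    by (intro word_cong.refl) (auto dest: notin_set_remove1[THEN contrapos_nn])
next
  case (sym xs ys)
  then show ?case by (rule word_cong.sym)
next
  case (trans xs ys zs)
  then show ?case by (rule word_cong.trans)
next
  case (swap a b l r)
  have sub: "remove1 c l \<in> lists (pverts H)" "remove1 c r \<in> lists (pverts H)"
    using swap set_remove1_subset[of c l] set_remove1_subset[of c r] by auto
  have sw: "(l' @ [a, b] @ r', l' @ [b, a] @ r') \<in> word_cong H"
    if "l' \<in> lists (pverts H)" "r' \<in> lists (pverts H)" for l' r'
    using swap that by (intro word_cong.append word_cong.refl word_cong.swap) (auto simp: linked_def)
  have rf: "(l @ x # r, l @ x # r) \<in> word_cong H" if "x \<in> pverts H" for x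
    using swap that by (intro word_cong.refl) auto
  show ?case
    using swap sub sw[of l "remove1 c r"] sw[of "remove1 c l" r] rf
    by (auto simp: remove1_append linked_def)
qed

text \<open>Reversal turns the last letter into the first, which is the one that
  \<open>remove1\<close> deletes.\<close>

lemma word_cong_snoc_cancel:
  assumes "(xs @ [c], ys @ [c]) \<in> word_cong H"
  shows "(xs, ys) \<in> word_cong H"
  using word_cong_rev[OF word_cong_remove1[OF word_cong_rev[OF assms], of c]] by simp

lemma word_cong_Cons_snoc:
  assumes "a \<in> pverts H" "xs \<in> lists (pverts H)" "\<forall>b\<in>set xs. \<not> linked H a b"
  shows "(a # xs, xs @ [a]) \<in> word_cong H"
  using assms(2,3)
proof (induction xs)
  case Nil
  then show ?case using assms(1) by (auto intro: word_cong.refl)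
next
  case (Cons b xs)
  then have "b \<in> pverts H" "xs \<in> lists (pverts H)"
    by auto
  then have "([a, b] @ xs, [b, a] @ xs) \<in> word_cong H"
    using Cons.prems assms(1)
    by (intro word_cong.append word_cong.swap word_cong.refl) (auto simp: linked_def)
  moreover have "(b # a # xs, b # xs @ [a]) \<in> word_cong H"
    using Cons by (intro word_cong_Cons) auto
  ultimately show ?case using word_cong.trans by fastforce
qed

section \<open>Splitting a word below a set of letters\<close>

text \<open>In the heap of \<open>xs\<close>, \<open>lower H X xs\<close> consists of the pieces below (or equal to) some piece
  with letter in \<open>X\<close>; the last letter of a word is at the top of the heap.\<close>

fun lower :: "'a pair_pre_digraph \<Rightarrow> 'a set \<Rightarrow> 'a list \<Rightarrow> 'a list" where
  "lower H X [] = []"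
| "lower H X (a # xs) =
    (if a \<in> X \<or> (\<exists>b\<in>set (lower H X xs). linked H a b) then a # lower H X xs else lower H X xs)"

fun upper :: "'a pair_pre_digraph \<Rightarrow> 'a set \<Rightarrow> 'a list \<Rightarrow> 'a list" where
  "upper H X [] = []"
| "upper H X (a # xs) =
    (if a \<in> X \<or> (\<exists>b\<in>set (lower H X xs). linked H a b) then upper H X xs else a # upper H X xs)"

text \<open>A piece of the heap is maximal when no later letter is linked to it, so the condition
  puts the letters of all maximal pieces into \<open>X\<close>. It is tested on lists to avoid
  reasoning in the quotient.\<close>

fun tops_in :: "'a pair_pre_digraph \<Rightarrow> 'a set \<Rightarrow> 'a list \<Rightarrow> bool" where
  "tops_in H X [] \<longleftrightarrow> True"
| "tops_in H X (a # xs) \<longleftrightarrow> (a \<in> X \<or> (\<exists>b\<in>set xs. linked H a b)) \<and> tops_in H X xs"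

lemma set_lower: "set (lower H X xs) \<subseteq> set xs"
  by (induction xs) auto

lemma set_upper: "set (upper H X xs) \<subseteq> set xs - X"
  by (induction xs) auto

lemma tops_in_lower: "tops_in H X (lower H X xs)"
  by (induction xs) auto

lemma tops_in_mono: "tops_in H X xs \<Longrightarrow> X \<subseteq> Y \<Longrightarrow> tops_in H Y xs"
  by (induction xs) auto

lemma tops_in_appendI: "tops_in H X xs \<Longrightarrow> tops_in H X ys \<Longrightarrow> tops_in H X (xs @ ys)"
  by (induction xs) auto

lemma tops_in_appendD: "tops_in H X (xs @ ys) \<Longrightarrow> tops_in H X ys"
  by (induction xs) auto

text \<open>The new top \<open>c\<close> covers exactly the letters linked to it, which therefore
  become admissible tops of the remaining word.\<close>

lemma tops_in_snoc:
  "tops_in H X (xs @ [c]) \<longleftrightarrow> c \<in> X \<and> tops_in H (X \<union> {a. linked H a c}) xs"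
  by (induction xs) auto

text \<open>Read the list from its end: each letter lies in \<open>X\<close> or is linked to a later
  one, so membership in \<open>S'\<close> propagates to the front.\<close>

lemma tops_in_closed:
  assumes "tops_in H X xs" "xs \<in> lists S" "S' \<subseteq> S" "X \<inter> S \<subseteq> S'"
    and "\<And>a b. a \<in> S' \<Longrightarrow> b \<in> S \<Longrightarrow> (b, a) \<in> parcs H \<Longrightarrow> b \<in> S'"
  shows "xs \<in> lists S'"
  using assms(1,2) by (induction xs) (use assms(3-) in \<open>auto simp: linked_def\<close>)

lemma tops_in_cong_set:
  "xs \<in> lists S \<Longrightarrow> X \<inter> S = Y \<inter> S \<Longrightarrow> tops_in H X xs \<longleftrightarrow> tops_in H Y xs"
  by (induction xs) auto

lemma lower_disjoint: "set xs \<inter> X = {} \<Longrightarrow> lower H X xs = [] \<and> upper H X xs = xs"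
  by (induction xs) auto

text \<open>This is uniqueness of the splitting: the two factors are recovered from the
  product.\<close>

lemma lower_append:
  "tops_in H X xs \<Longrightarrow> set ys \<inter> X = {} \<Longrightarrow> lower H X (xs @ ys) = xs \<and> upper H X (xs @ ys) = ys"
  by (induction xs) (auto simp: lower_disjoint)

lemma upper_Nil_iff: "upper H X xs = [] \<longleftrightarrow> tops_in H X xs"
proof
  have "upper H X xs = [] \<Longrightarrow> lower H X xs = xs"
    by (induction xs) (auto split: if_splits)
  then show "upper H X xs = [] \<Longrightarrow> tops_in H X xs"
    by (metis tops_in_lower)
  show "tops_in H X xs \<Longrightarrow> upper H X xs = []"
    using lower_append[of H X xs "[]"] by simp
qed

text \<open>A letter sent to \<open>upper\<close> is linked to nothing in the lower part of the list
  behind it, so it commutes past that part.\<close>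

lemma lower_upper_cong:
  assumes "xs \<in> lists (pverts H)"
  shows "(xs, lower H X xs @ upper H X xs) \<in> word_cong H"
  using assms
proof (induction xs)
  case Nil
  then show ?case by (auto intro: word_cong.refl)
next
  case (Cons a xs)
  then have IH: "(a # xs, a # lower H X xs @ upper H X xs) \<in> word_cong H"
    by (auto intro: word_cong_Cons)
  have u: "upper H X xs \<in> lists (pverts H)" and l: "lower H X xs \<in> lists (pverts H)"
    using Cons.hyps set_upper[of H X xs] set_lower[of H X xs] by auto
  show ?case
  proof (cases "a \<in> X \<or> (\<exists>b\<in>set (lower H X xs). linked H a b)")
    case True
    then show ?thesis using IH by simp
  next
    case False
    have "((a # lower H X xs) @ upper H X xs, (lower H X xs @ [a]) @ upper H X xs) \<in> word_cong H"
      using Cons.hyps u l False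
      by (intro word_cong.append word_cong_Cons_snoc word_cong.refl) auto
    with IH have "(a # xs, (lower H X xs @ [a]) @ upper H X xs) \<in> word_cong H"
      using word_cong.trans by fastforce
    then show ?thesis using False by simp
  qed
qed

text \<open>This makes the splitting well defined on classes. In a swap, neither of the two unlinked
  letters influences the test for the other.\<close>

lemma lower_upper_word_cong:
  assumes "(xs, ys) \<in> word_cong H" and H: "sym (parcs H)"
  shows "(lower H X xs, lower H X ys) \<in> word_cong H \<and> (upper H X xs, upper H X ys) \<in> word_cong H"
  using assms(1)
proof (induction rule: word_cong_swap_induct)
  case (refl xs)
  then have "lower H X xs \<in> lists (pverts H)" "upper H X xs \<in> lists (pverts H)"
    using set_upper[of H X xs] set_lower[of H X xs] by auto
  then show ?case by (auto intro: word_cong.refl)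
next
  case (sym xs ys)
  then show ?case by (simp add: word_cong.sym)
next
  case (trans xs ys zs)
  then show ?case using word_cong.trans by blast
next
  case (swap a b l r)
  have ab: "\<not> linked H a b" "\<not> linked H b a"
    using swap linked_commute[OF H] by auto
  from \<open>l \<in> lists (pverts H)\<close> show ?case
  proof (induction l)
    case Nil
    have sub: "lower H X r \<in> lists (pverts H)" "upper H X r \<in> lists (pverts H)"
      using swap set_upper[of H X r] set_lower[of H X r] by auto
    have rf: "(zs, zs) \<in> word_cong H" "(a # zs, a # zs) \<in> word_cong H"
        "(b # zs, b # zs) \<in> word_cong H" "([a, b] @ zs, [b, a] @ zs) \<in> word_cong H"
      if "zs \<in> lists (pverts H)" for zs
      using that swap
      by (auto simp: linked_def intro!: word_cong.refl word_cong.append word_cong.swap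
          simp del: append_Cons append_Nil)
    show ?case using ab rf sub by auto
  next
    case (Cons c l)
    \<comment> \<open>The test for the prefixed letter \<open>c\<close> depends only on the set of
      letters in the lower part, so it has the same outcome on both sides.\<close>
    then have "set (lower H X (l @ a # b # r)) = set (lower H X (l @ b # a # r))"
      using word_cong_set by blast
    then show ?case using Cons by (auto intro: word_cong_Cons)
  qed
qed

text \<open>The condition amounts to an empty upper part, and congruent words have congruent upper
  parts.\<close>

lemma tops_in_word_cong:
  "(xs, ys) \<in> word_cong H \<Longrightarrow> sym (parcs H) \<Longrightarrow> tops_in H X xs \<longleftrightarrow> tops_in H X ys"
  by (metis lower_upper_word_cong upper_Nil_iff word_cong_mset mset_zero_iff)

lemma tops_in_iff_initial_alphabet:
  assumes "xs \<in> lists (pverts H)" "sym (parcs H)"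
  shows "initial_alphabet H (word_class H xs) \<subseteq> X \<longleftrightarrow> tops_in H X xs"
proof
  assume *: "tops_in H X xs"
  show "initial_alphabet H (word_class H xs) \<subseteq> X"
  proof
    fix v assume "v \<in> initial_alphabet H (word_class H xs)"
    then obtain zs where v: "v \<in> pverts H" "zs \<in> lists (pverts H)"
        "word_class H xs = word_class H zs \<otimes>\<^bsub>word_monoid H\<^esub> word_class H [v]"
      by (auto simp: initial_alphabet_def word_monoid_carrier)
    then have "word_class H xs = word_class H (zs @ [v])"
      by (simp add: word_monoid_mult)
    then show "v \<in> X"
      using * assms tops_in_word_cong tops_in_snoc by (metis word_class_eq_iff)
  qed
next
  assume *: "initial_alphabet H (word_class H xs) \<subseteq> X"
  show "tops_in H X xs"
  proof -
    \<comment> \<open>The claim is proved for every suffix. A letter linked to nothing after it can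
      be moved to the end, so it belongs to the initial alphabet and hence to
      \<open>X\<close>.\<close>
    have "tops_in H X ys" if "xs = zs @ ys" for zs ys
      using that
    proof (induction ys arbitrary: zs)
      case (Cons a ys)
      have "a \<in> X" if "\<forall>b\<in>set ys. \<not> linked H a b"
      proof -
        have "(a # ys, ys @ [a]) \<in> word_cong H"
          using that Cons.prems assms(1) by (intro word_cong_Cons_snoc) auto
        then have "(xs, zs @ ys @ [a]) \<in> word_cong H"
          using Cons.prems assms(1) by (auto intro!: word_cong.append word_cong.refl)
        then have "word_class H xs =
            word_class H (zs @ ys) \<otimes>\<^bsub>word_monoid H\<^esub> word_class H [a]"
          using Cons.prems assms(1) by (simp add: word_monoid_mult word_class_eq)
        moreover have "word_class H (zs @ ys) \<in> carrier (word_monoid H)" "a \<in> pverts H"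
          using Cons.prems assms(1) by (auto simp: word_monoid_carrier)
        ultimately show "a \<in> X"
          using * unfolding initial_alphabet_def by blast
      qed
      then show ?case using Cons.IH[of "zs @ [a]"] Cons.prems by auto
    qed simp
    then show ?thesis by blast
  qed
qed

text \<open>Classes are formed in \<open>H\<close> and not in the subgraph on \<open>S\<close>, so
  that factors with different letter sets multiply in one monoid. For a singleton \<open>X\<close>
  these are the pyramids of heap theory and the empty heap.\<close>

definition pyramids :: "'a pair_pre_digraph \<Rightarrow> 'a set \<Rightarrow> 'a set \<Rightarrow> 'a list set set" where
  "pyramids H S X = word_class H ` {xs \<in> lists S. tops_in H X xs}"

lemma words_at_eq_pyramids:
  assumes "sym (parcs H)"
  shows "words_at H x = pyramids H (pverts H) {x}"
proof -
  have "word_class H [] \<in> pyramids H (pverts H) {x}"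
    unfolding pyramids_def by (rule image_eqI[of _ _ "[]"]) auto
  moreover have "w \<in> pyramids H (pverts H) {x} \<longleftrightarrow>
      w \<in> word_class H ` lists (pverts H) \<and> initial_alphabet H w \<subseteq> {x}" for w
    using tops_in_iff_initial_alphabet[OF _ assms, of _ "{x}"] by (auto simp: pyramids_def)
  ultimately show ?thesis
    by (auto simp: words_at_def word_monoid_carrier word_monoid_one)
qed

section \<open>Decompositions of sets of pyramids\<close>

abbreviation weight :: "('a \<Rightarrow> 'c) \<Rightarrow> 'a list set \<Rightarrow> 'c multiset" where
  "weight h w \<equiv> image_mset h (word_comm w)"

lemma pyramids_cong: "X \<inter> S = Y \<inter> S \<Longrightarrow> pyramids H S X = pyramids H S Y"
  using tops_in_cong_set[of _ S X Y H] unfolding pyramids_def by (intro image_cong) auto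

text \<open>The tops lie in \<open>S'\<close>, and \<open>S'\<close> absorbs its neighbours within
  \<open>S\<close>, so nothing outside \<open>S'\<close> can lie below a top. This confines pyramids
  to a component or a subtree.\<close>

lemma pyramids_restrict:
  assumes "S' \<subseteq> S" "X \<inter> S \<subseteq> S'"
    and "\<And>a b. a \<in> S' \<Longrightarrow> b \<in> S \<Longrightarrow> (b, a) \<in> parcs H \<Longrightarrow> b \<in> S'"
  shows "pyramids H S X = pyramids H S' X"
proof -
  have "xs \<in> lists S'" if "xs \<in> lists S" "tops_in H X xs" for xs
    using tops_in_closed[OF that(2,1) assms] .
  then have "{xs \<in> lists S. tops_in H X xs} = {xs \<in> lists S'. tops_in H X xs}"
    using lists_mono[OF assms(1)] by blast
  then show ?thesis by (simp add: pyramids_def)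
qed

lemma pyramids_empty: "pyramids H S {} = {word_class H []}"
proof -
  have "pyramids H S {} = pyramids H {} {}"
    by (rule pyramids_restrict) auto
  also have "{xs \<in> lists {}. tops_in H {} xs} = {[]}"
    by auto
  then have "pyramids H {} {} = {word_class H []}"
    by (simp add: pyramids_def)
  finally show ?thesis .
qed

text \<open>The bijection is multiplication: the first factor is the part of the product below
  letters of \<open>X\<close>, and the second is the rest.\<close>

lemma pyramids_split:
  assumes H: "sym (parcs H)" and "S \<subseteq> pverts H" "X \<subseteq> Y"
  shows "weight_equiv (pyramids H S X \<times> pyramids H (S - X) Y)
    (\<lambda>(w, z). weight h w + weight h z) (pyramids H S Y) (weight h)"
proof -
  let ?L = "{xs \<in> lists S. tops_in H X xs} \<times> {ys \<in> lists (S - X). tops_in H Y ys}"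
  let ?p = "map_prod (word_class H) (word_class H)" and ?q = "\<lambda>(xs, ys). word_class H (xs @ ys)"
  have in_lists: "xs \<in> lists (pverts H)" if "xs \<in> lists S" for xs
    using that assms(2) by auto
  have "weight_equiv (?p ` ?L) (\<lambda>(w, z). weight h w + weight h z) (?q ` ?L) (weight h)"
  proof (rule weight_equiv_image)
    fix a assume "a \<in> ?L"
    then obtain xs ys where a: "a = (xs, ys)" and "xs \<in> lists S" "ys \<in> lists (S - X)"
      by blast
    then have "xs \<in> lists (pverts H)" "ys \<in> lists (pverts H)"
      using in_lists by auto
    then show "(case ?p a of (w, z) \<Rightarrow> weight h w + weight h z) = weight h (?q a)"
      using word_comm_class[of "xs @ ys" H] by (simp add: a word_comm_class)
  next
    fix a b assume "a \<in> ?L" "b \<in> ?L"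
    then obtain xs ys xs' ys' where ab: "a = (xs, ys)" "b = (xs', ys')"
      and *: "xs \<in> lists S" "ys \<in> lists (S - X)" "xs' \<in> lists S" "ys' \<in> lists (S - X)"
      "tops_in H X xs" "tops_in H X xs'"
      by blast
    then have V: "xs \<in> lists (pverts H)" "ys \<in> lists (pverts H)"
      using in_lists by auto
    have disj: "set ys \<inter> X = {}" "set ys' \<inter> X = {}"
      using * by auto
    \<comment> \<open>Applying \<open>lower\<close> and \<open>upper\<close> to congruent products
      returns the two factors separately.\<close>
    have "(xs @ ys, xs' @ ys') \<in> word_cong H \<longleftrightarrow>
        (xs, xs') \<in> word_cong H \<and> (ys, ys') \<in> word_cong H"
      using lower_upper_word_cong[OF _ H, of "xs @ ys" "xs' @ ys'" X]
        lower_append[OF *(5) disj(1)] lower_append[OF *(6) disj(2)]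
      by (auto intro: word_cong.append)
    moreover have "word_class H (xs @ ys) = word_class H (xs' @ ys') \<longleftrightarrow>
        (xs @ ys, xs' @ ys') \<in> word_cong H"
      using V by (intro word_class_eq_iff) simp
    ultimately show "?p a = ?p b \<longleftrightarrow> ?q a = ?q b"
      using V by (simp add: ab word_class_eq_iff)
  qed
  moreover have "?p ` ?L = pyramids H S X \<times> pyramids H (S - X) Y"
    unfolding pyramids_def by force
  moreover have "?q ` ?L = pyramids H S Y"
  proof (rule subset_antisym)
    show "?q ` ?L \<subseteq> pyramids H S Y"
    proof
      fix w assume "w \<in> ?q ` ?L"
      then obtain xs ys where *: "xs \<in> lists S" "ys \<in> lists (S - X)"
        "tops_in H X xs" "tops_in H Y ys" "w = word_class H (xs @ ys)"
        by blast
      have "tops_in H Y (xs @ ys)"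
        using tops_in_appendI[OF tops_in_mono[OF *(3) \<open>X \<subseteq> Y\<close>] *(4)] .
      moreover have "xs @ ys \<in> lists S"
        using * by auto
      ultimately show "w \<in> pyramids H S Y"
        using *(5) by (simp add: pyramids_def)
    qed
    show "pyramids H S Y \<subseteq> ?q ` ?L"
    proof
      fix w assume "w \<in> pyramids H S Y"
      then obtain zs where zs: "zs \<in> lists S" "tops_in H Y zs" "w = word_class H zs"
        unfolding pyramids_def by blast
      let ?xs = "lower H X zs" and ?ys = "upper H X zs"
      have cong: "(zs, ?xs @ ?ys) \<in> word_cong H"
        by (rule lower_upper_cong[OF in_lists[OF zs(1)]])
      then have "tops_in H Y ?ys"
        using zs(2) tops_in_word_cong[OF cong H] by (auto intro: tops_in_appendD)
      moreover have "?xs \<in> lists S" "?ys \<in> lists (S - X)"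
        using zs(1) set_lower[of H X zs] set_upper[of H X zs] by auto
      ultimately have "(?xs, ?ys) \<in> ?L"
        by (simp add: tops_in_lower)
      moreover have "w = ?q (?xs, ?ys)"
        using word_class_eq[OF cong] zs(3) by simp
      ultimately show "w \<in> ?q ` ?L"
        by (rule rev_image_eqI)
    qed
  qed
  ultimately show ?thesis by simp
qed

text \<open>The map \<open>f\<close> embeds \<open>H\<close> as an induced subgraph of
  \<open>T\<close>, so linkedness, and with it congruence and tops, transfers in both
  directions.\<close>

lemma pyramids_relabel:
  assumes inj: "inj_on f (pverts H)" and sub: "f ` pverts H \<subseteq> pverts T"
    and arcs: "\<And>a b. a \<in> pverts H \<Longrightarrow> b \<in> pverts H \<Longrightarrow>
      (f a, f b) \<in> parcs T \<longleftrightarrow> (a, b) \<in> parcs H"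
    and X: "X \<subseteq> pverts H"
  shows "weight_equiv (pyramids H (pverts H) X) (weight (\<lambda>a. h (f a)))
    (pyramids T (f ` pverts H) (f ` X)) (weight h)"
proof -
  let ?V = "pverts H"
  let ?L = "{xs \<in> lists ?V. tops_in H X xs}"
  have linked: "linked T (f a) (f b) \<longleftrightarrow> linked H a b" if "a \<in> ?V" "b \<in> ?V" for a b
    using that inj arcs by (auto simp: linked_def dest: inj_onD)
  have in_lists: "map f xs \<in> lists (pverts T)" if "xs \<in> lists ?V" for xs
    using that sub by fastforce
  have inv: "map (inv_into ?V f) (map f xs) = xs" if "xs \<in> lists ?V" for xs
    using that inj by (induction xs) auto
  have cong: "(map f xs, map f ys) \<in> word_cong T \<longleftrightarrow> (xs, ys) \<in> word_cong H"
    if "xs \<in> lists ?V" "ys \<in> lists ?V" for xs ys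
  proof
    show "(map f xs, map f ys) \<in> word_cong T" if "(xs, ys) \<in> word_cong H"
      using that \<open>xs \<in> lists ?V\<close> sub linked by (intro word_cong_map[where S = ?V]) auto
    assume "(map f xs, map f ys) \<in> word_cong T"
    then have "(map (inv_into ?V f) (map f xs), map (inv_into ?V f) (map f ys)) \<in> word_cong H"
      using \<open>xs \<in> lists ?V\<close> inj linked
      by (intro word_cong_map[where S = "f ` ?V"]) auto
    then show "(xs, ys) \<in> word_cong H"
      using inv that by simp
  qed
  have tops: "tops_in T (f ` X) (map f xs) \<longleftrightarrow> tops_in H X xs" if "xs \<in> lists ?V" for xs
    using that
  proof (induction xs)
    case (Cons a xs)
    have "f a \<in> f ` X \<longleftrightarrow> a \<in> X"
      using inj_on_image_mem_iff[OF inj Cons.hyps(1) X] .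
    moreover have "(\<exists>b\<in>set xs. linked T (f a) (f b)) \<longleftrightarrow> (\<exists>b\<in>set xs. linked H a b)"
      using linked Cons.hyps by (intro bex_cong) auto
    ultimately show ?case using Cons.IH by simp
  qed simp
  have "weight_equiv (word_class H ` ?L) (weight (\<lambda>a. h (f a)))
      ((\<lambda>xs. word_class T (map f xs)) ` ?L) (weight h)"
  proof (rule weight_equiv_image)
    fix xs assume "xs \<in> ?L"
    then show "weight (\<lambda>a. h (f a)) (word_class H xs) = weight h (word_class T (map f xs))"
      using in_lists[of xs] by (simp add: word_comm_class multiset.map_comp comp_def)
  next
    fix xs ys assume "xs \<in> ?L" "ys \<in> ?L"
    then show "word_class H xs = word_class H ys \<longleftrightarrow>
        word_class T (map f xs) = word_class T (map f ys)"
      using in_lists cong by (simp add: word_class_eq_iff)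
  qed
  moreover have "{zs \<in> lists (f ` ?V). tops_in T (f ` X) zs} = map f ` ?L"
    using tops by (auto simp: lists_image)
  ultimately show ?thesis
    by (simp add: pyramids_def image_image)
qed

section \<open>Words at a vertex as a free monoid\<close>

lemma neighbours_subset: "pair_graph H \<Longrightarrow> neighbours H u \<subseteq> pverts H - {u}"
  unfolding neighbours_def
  by (auto dest: pair_wf_digraph.in_arcsD2 pair_loopfree_digraph.no_loops'
      simp: pair_graph_def pair_digraph_def pair_fin_digraph_def)

lemma sym_parcs: "pair_graph H \<Longrightarrow> sym (parcs H)"
  by (meson pair_graph_def pair_pseudo_graph_def pair_sym_digraph.arcs_symmetric symI)

text \<open>A list representing a nonempty word at \<open>u\<close> ends in \<open>u\<close>.
  Stripping this letter can expose only \<open>u\<close> and its neighbours, and cancellation makes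
  the passage injective.\<close>

lemma words_at_snoc:
  assumes H: "sym (parcs H)" and u: "u \<in> pverts H"
  shows "weight_equiv (pyramids H (pverts H) (insert u (neighbours H u)))
    (\<lambda>w. weight h w + {#h u#}) (words_at H u - {word_class H []}) (weight h)"
proof -
  let ?V = "pverts H"
  let ?L = "{xs \<in> lists ?V. tops_in H (insert u (neighbours H u)) xs}"
  have tops: "tops_in H {u} (xs @ [u]) \<longleftrightarrow> tops_in H (insert u (neighbours H u)) xs" for xs
  proof -
    have "{u} \<union> {a. linked H a u} = insert u (neighbours H u)"
      using symD[OF H] by (auto simp: linked_def neighbours_def)
    then show ?thesis by (simp add: tops_in_snoc)
  qed
  have in_lists: "xs @ [u] \<in> lists ?V" if "xs \<in> lists ?V" for xs
    using that u by auto
  have "weight_equiv (word_class H ` ?L) (\<lambda>w. weight h w + {#h u#})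
      ((\<lambda>xs. word_class H (xs @ [u])) ` ?L) (weight h)"
  proof (rule weight_equiv_image)
    fix xs assume "xs \<in> ?L"
    then show "weight h (word_class H xs) + {#h u#} = weight h (word_class H (xs @ [u]))"
      using in_lists[of xs] by (simp add: word_comm_class)
  next
    fix xs ys assume *: "xs \<in> ?L" "ys \<in> ?L"
    have "(xs @ [u], ys @ [u]) \<in> word_cong H \<longleftrightarrow> (xs, ys) \<in> word_cong H"
      using word_cong_snoc_cancel[of xs u ys H] u
        word_cong.append[of xs ys H "[u]" "[u]"] word_cong.refl[of "[u]" H] by auto
    then show "word_class H xs = word_class H ys \<longleftrightarrow>
        word_class H (xs @ [u]) = word_class H (ys @ [u])"
      using * in_lists[of xs] by (simp add: word_class_eq_iff)
  qed
  moreover have "(\<lambda>xs. word_class H (xs @ [u])) ` ?L = words_at H u - {word_class H []}"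
  proof -
    have nonempty: "word_class H (xs @ [u]) \<noteq> word_class H []" if "xs \<in> lists ?V" for xs
      using word_length_class[OF in_lists[OF that]] word_length_class[of "[]" H] by auto
    have "w \<in> (\<lambda>xs. word_class H (xs @ [u])) ` ?L"
      if w: "w \<in> words_at H u" "w \<noteq> word_class H []" for w
    proof -
      obtain zs where zs: "zs \<in> lists ?V" "tops_in H {u} zs" "w = word_class H zs"
        using w(1) by (auto simp: words_at_eq_pyramids[OF H] pyramids_def)
      with w(2) obtain xs v where "zs = xs @ [v]"
        by (cases zs rule: rev_cases) auto
      with zs tops show ?thesis
        by (auto simp: tops_in_snoc)
    qed
    moreover have "word_class H (xs @ [u]) \<in> words_at H u" if "xs \<in> ?L" for xs
      using that tops[of xs] in_lists[of xs] by (simp add: words_at_eq_pyramids[OF H] pyramids_def)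
    ultimately show ?thesis
      by (intro subset_antisym image_subsetI subsetI) (simp_all add: nonempty)
  qed
  ultimately show ?thesis by (simp add: pyramids_def)
qed

text \<open>Splitting the stripped word at \<open>u\<close> leaves a word at \<open>u\<close> times
  a factor avoiding \<open>u\<close> with tops among its neighbours. This is the recursion solved by
  \<open>weight_equiv_star\<close>; each generator is such a factor followed by
  \<open>u\<close>.\<close>

lemma words_at_star:
  assumes H: "sym (parcs H)" and u: "u \<in> pverts H"
  shows "weight_equiv (lists (pyramids H (pverts H - {u}) (neighbours H u)))
    (\<lambda>l. sum_list (map (\<lambda>q. weight h q + {#h u#}) l)) (words_at H u) (weight h)"
proof (rule weight_equiv_star)
  let ?Y = "insert u (neighbours H u)" and ?V = "pverts H"
  have "weight_equiv (pyramids H ?V {u} \<times> pyramids H (?V - {u}) ?Y)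
      (\<lambda>(w, z). weight h w + weight h z) (pyramids H ?V ?Y) (weight h)"
    by (rule pyramids_split[OF H]) auto
  moreover have "pyramids H (?V - {u}) ?Y = pyramids H (?V - {u}) (neighbours H u)"
    by (rule pyramids_cong) auto
  ultimately have "weight_equiv (words_at H u \<times> pyramids H (?V - {u}) (neighbours H u))
      (\<lambda>(w, z). weight h w + weight h z) (pyramids H ?V ?Y) (weight h)"
    by (simp add: words_at_eq_pyramids[OF H])
  from weight_equiv_trans[OF weight_equiv_map[OF this, of "\<lambda>m. m + {#h u#}"]
      words_at_snoc[OF assms]]
  show "weight_equiv (words_at H u \<times> pyramids H (?V - {u}) (neighbours H u))
      (\<lambda>(w, q). weight h w + (weight h q + {#h u#}))
      (words_at H u - {word_class H []}) (weight h)"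
    by (simp add: case_prod_unfold add.assoc)
  show "word_class H [] \<in> words_at H u"
    by (simp add: words_at_def word_monoid_one)
  show "weight h (word_class H []) = {#}"
    by (simp add: word_comm_class)
qed simp

text \<open>Both sides are free monoids, so it suffices to match generators; their final letters
  contribute equal weights \<open>h u = k v\<close>.\<close>

lemma words_at_weight_equiv:
  assumes "sym (parcs H)" "sym (parcs K)" "u \<in> pverts H" "v \<in> pverts K" "h u = k v"
    and "weight_equiv (pyramids H (pverts H - {u}) (neighbours H u)) (weight h)
      (pyramids K (pverts K - {v}) (neighbours K v)) (weight k)"
  shows "weight_equiv (words_at H u) (weight h) (words_at K v) (weight k)"
proof -
  have "weight_equiv (lists (pyramids H (pverts H - {u}) (neighbours H u)))
      (\<lambda>l. sum_list (map (\<lambda>q. weight h q + {#h u#}) l))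
      (lists (pyramids K (pverts K - {v}) (neighbours K v)))
      (\<lambda>l. sum_list (map (\<lambda>q. weight k q + {#k v#}) l))"
    using weight_equiv_lists[OF weight_equiv_map[OF assms(6), of "\<lambda>m. m + {#h u#}"]] assms(5)
    by simp
  then show ?thesis
    using weight_equiv_trans[OF weight_equiv_trans[OF
          weight_equiv_sym[OF words_at_star[OF assms(1,3)]]] words_at_star[OF assms(2,4)]]
    by blast
qed

section \<open>The branches of the stable-path tree\<close>

text \<open>Below a top \<open>y\<close>, every letter is joined to \<open>y\<close> by a path
  inside \<open>S\<close>, so it lies in the component of \<open>y\<close>.\<close>

lemma branch_restrict:
  fixes G :: "'a::linorder pair_pre_digraph"
  assumes G: "pair_graph G" and y: "y \<in> neighbours G u"
  defines "S \<equiv> pverts G - ({u} \<union> {z \<in> neighbours G u. z < y})"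
  shows "pyramids G S {y} = pyramids G (pverts (branch G u y)) {y}"
proof (rule pyramids_restrict)
  let ?K = "pair_induce G S"
  have K: "pair_graph ?K"
    by (rule pair_graph_pair_induce[OF G]) (auto simp: S_def)
  then interpret K: pair_graph ?K .
  have verts: "pverts (branch G u y) = pre_digraph.scc_of (with_proj ?K) y"
    by (simp add: branch_def component_at_def pair_induce_def S_def)
  show "pverts (branch G u y) \<subseteq> S"
    unfolding verts
    by (auto simp: pre_digraph.scc_of_def reachable_def pair_induce_def dest: in_rtrancl_on_in_F)
  show "{y} \<inter> S \<subseteq> pverts (branch G u y)"
    using branch_props(2)[OF G y] by auto
  fix a b assume a: "a \<in> pverts (branch G u y)" and b: "b \<in> S" "(b, a) \<in> parcs G"
  have "a \<in> S"
    using a \<open>pverts (branch G u y) \<subseteq> S\<close> by auto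
  then have "(b, a) \<in> parcs ?K"
    using b by (auto simp: pair_induce_def)
  \<comment> \<open>Components are strongly connected ones, so reachability is needed both ways;
    symmetry supplies the reverse arc.\<close>
  then have ends: "(b, a) \<in> parcs ?K" "(a, b) \<in> parcs ?K"
    using symD[OF sym_parcs[OF K]] by simp_all
  have "y \<rightarrow>\<^sup>*\<^bsub>with_proj ?K\<^esub> a" "a \<rightarrow>\<^sup>*\<^bsub>with_proj ?K\<^esub> y"
    using a unfolding verts pre_digraph.scc_of_def by auto
  then have "y \<rightarrow>\<^sup>*\<^bsub>with_proj ?K\<^esub> b" "b \<rightarrow>\<^sup>*\<^bsub>with_proj ?K\<^esub> y"
    using K.reachable_adj_trans[OF _ ends(2)] K.adj_reachable_trans[OF ends(1)] by simp_all
  then show "b \<in> pverts (branch G u y)"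
    unfolding verts pre_digraph.scc_of_def by simp
qed

text \<open>The branch is an induced subgraph, so relabelling by the identity passes from its monoid
  to that of \<open>G\<close>.\<close>

lemma branch_weight_equiv:
  fixes G :: "'a::linorder pair_pre_digraph"
  assumes G: "pair_graph G" and y: "y \<in> neighbours G u"
  shows "weight_equiv (words_at (branch G u y) y) (weight h)
    (pyramids G (pverts G - ({u} \<union> {z \<in> neighbours G u. z < y})) {y}) (weight h)"
proof -
  let ?B = "branch G u y"
  note B = branch_props[OF G y]
  have "(a, b) \<in> parcs G \<longleftrightarrow> (a, b) \<in> parcs ?B" if "a \<in> pverts ?B" "b \<in> pverts ?B" for a b
    using that by (auto simp: branch_def component_at_def pair_induce_def
        pre_digraph.scc_of_def reachable_def dest: in_rtrancl_on_in_F)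
  then have "weight_equiv (pyramids ?B (pverts ?B) {y}) (weight h)
      (pyramids G ((\<lambda>a. a) ` pverts ?B) ((\<lambda>a. a) ` {y})) (weight h)"
    using B(2) pverts_branch_subset[of G u y] by (intro pyramids_relabel) auto
  then show ?thesis
    using branch_restrict[OF assms] by (simp add: words_at_eq_pyramids[OF sym_parcs[OF B(1)]])
qed

section \<open>One step of the tree recursion\<close>

context
  fixes G :: "'a::linorder pair_pre_digraph" and u :: 'a and T N Tx
  assumes G: "pair_graph G" and u: "u \<in> pverts G"
  defines "T \<equiv> stable_path_tree G u" and "N \<equiv> neighbours G u"
    and "Tx \<equiv> \<lambda>x. stable_path_tree (branch G u x) x"
begin

lemma pverts_tree: "pverts T = {[u]} \<union> (\<Union>x\<in>N. Cons u ` pverts (Tx x))"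
  and parcs_tree: "parcs T = (\<Union>x\<in>N. {([u], [u, x]), ([u, x], [u])} \<union>
    map_prod (Cons u) (Cons u) ` parcs (Tx x))"
  using u pair_fin_digraph.pair_finite_verts[of G] G
  unfolding T_def N_def Tx_def pair_graph_def pair_digraph_def
  by (subst stable_path_tree.simps; simp)+

lemma subtree_arc:
  assumes "x \<in> N" "(p, q) \<in> parcs (Tx x)"
  shows "p \<in> pverts (Tx x)" "q \<in> pverts (Tx x)"
proof -
  have "pair_graph (Tx x)"
    unfolding Tx_def using assms(1) branch_props(1)[OF G]
    by (intro pair_graph_stable_path_tree) (simp add: N_def)
  then interpret pair_graph "Tx x" .
  show "p \<in> pverts (Tx x)" "q \<in> pverts (Tx x)"
    using assms(2) by (auto dest: in_arcsD1 in_arcsD2)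
qed

lemma subtree_vertex: "p \<in> pverts (Tx x) \<Longrightarrow> p \<noteq> [] \<and> hd p = x"
  unfolding Tx_def by (rule hd_stable_path_tree)

lemma subtree_root: "[x] \<in> pverts (Tx x)"
  unfolding Tx_def by (rule root_in_stable_path_tree)

lemma pverts_tree_minus_root: "pverts T - {[u]} = (\<Union>x\<in>N. Cons u ` pverts (Tx x))"
  using subtree_vertex by (auto simp: pverts_tree)

lemma neighbours_tree_root: "neighbours T [u] = (\<lambda>x. [u, x]) ` N"
  using subtree_arc(1) subtree_vertex by (fastforce simp: neighbours_def parcs_tree)

text \<open>As \<open>p\<close> and \<open>q\<close> are nonempty, the arc avoids the root, and the
  head of \<open>q\<close> determines the subtree containing it.\<close>

lemma subtree_closed:
  assumes "(u # p, u # q) \<in> parcs T" "x \<in> N" "q \<in> pverts (Tx x)" "p \<noteq> []"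
  shows "(p, q) \<in> parcs (Tx x)"
proof -
  obtain y where y: "y \<in> N" "(p, q) \<in> parcs (Tx y)"
    using assms subtree_vertex by (fastforce simp: parcs_tree)
  then have "y = x"
    using subtree_arc(2) subtree_vertex assms(3) by blast
  with y(2) show ?thesis by simp
qed

text \<open>Away from the root, distinct subtrees are not adjacent. The form fits the closure
  condition of \<open>pyramids_restrict\<close>.\<close>

lemma subtree_restrict:
  assumes "x \<in> Y" "Y \<subseteq> N" "S \<subseteq> (\<Union>y\<in>Y. Cons u ` pverts (Tx y))"
    and "a \<in> Cons u ` pverts (Tx x)" "b \<in> S" "(b, a) \<in> parcs T"
  shows "b \<in> Cons u ` pverts (Tx x)"
proof -
  obtain q where q: "a = u # q" "q \<in> pverts (Tx x)"
    using assms(4) by auto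
  have "b \<in> (\<Union>y\<in>Y. Cons u ` pverts (Tx y))"
    using assms(3,5) by (rule subsetD)
  then obtain y p where p: "b = u # p" "p \<in> pverts (Tx y)"
    by auto
  have "x \<in> N"
    using assms by auto
  then have "(p, q) \<in> parcs (Tx x)"
    using subtree_closed[of p q x] assms(6) subtree_vertex[OF p(2)] p q by simp
  then show ?thesis
    using subtree_arc(1)[OF \<open>x \<in> N\<close>] p(1) by blast
qed

text \<open>Prefixing \<open>u\<close> embeds the subtree into \<open>T\<close> and keeps the last
  entry of each vertex, hence its label.\<close>

lemma subtree_weight_equiv:
  assumes x: "x \<in> N"
  shows "weight_equiv (words_at (Tx x) [x]) (weight tree_label)
    (pyramids T (Cons u ` pverts (Tx x)) {[u, x]}) (weight tree_label)"
proof -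
  have graph: "pair_graph (Tx x)"
    unfolding Tx_def using x branch_props(1)[OF G]
    by (intro pair_graph_stable_path_tree) (simp add: N_def)
  have "weight_equiv (pyramids (Tx x) (pverts (Tx x)) {[x]}) (weight (\<lambda>p. tree_label (u # p)))
      (pyramids T (Cons u ` pverts (Tx x)) (Cons u ` {[x]})) (weight tree_label)"
  proof (rule pyramids_relabel)
    show "Cons u ` pverts (Tx x) \<subseteq> pverts T"
      using x by (auto simp: pverts_tree)
    show "(u # p, u # q) \<in> parcs T \<longleftrightarrow> (p, q) \<in> parcs (Tx x)"
      if "p \<in> pverts (Tx x)" "q \<in> pverts (Tx x)" for p q
    proof
      show "(u # p, u # q) \<in> parcs T \<Longrightarrow> (p, q) \<in> parcs (Tx x)"
        using subtree_closed x that subtree_vertex by blast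
      show "(p, q) \<in> parcs (Tx x) \<Longrightarrow> (u # p, u # q) \<in> parcs T"
        using x by (force simp: parcs_tree)
    qed
  qed (use subtree_root in auto)
  moreover have "weight (\<lambda>p. tree_label (u # p)) w = weight tree_label w"
    if w: "w \<in> pyramids (Tx x) (pverts (Tx x)) {[x]}" for w
  proof -
    obtain xs where xs: "xs \<in> lists (pverts (Tx x))" "w = word_class (Tx x) xs"
      using w unfolding pyramids_def by blast
    have "tree_label (u # p) = tree_label p" if "p \<in> set xs" for p
      using that xs(1) tree_label_branch[of p G u x] by (auto simp: Tx_def)
    then show ?thesis
      using xs by (auto simp: word_comm_class intro: image_mset_cong)
  qed
  ultimately show ?thesis
    by (auto simp: words_at_eq_pyramids[OF sym_parcs[OF graph]] intro: weight_equiv_cong[rotated 2])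
qed

text \<open>Removing the neighbours of \<open>u\<close> in increasing order splits off one branch at a time, with
  the vertex set that the definition of \<^const>\<open>branch\<close> prescribes.\<close>

lemma branches_weight_equiv:
  assumes IH: "\<And>x. x \<in> N \<Longrightarrow> weight_equiv (words_at (branch G u x) x) (weight id)
      (words_at (Tx x) [x]) (weight tree_label)"
    and "finite Y" "Y \<subseteq> N" "\<forall>y\<in>Y. \<forall>z\<in>N. y < z \<longrightarrow> z \<in> Y"
  shows "weight_equiv (pyramids G (pverts G - ({u} \<union> (N - Y))) Y) (weight id)
    (pyramids T (\<Union>x\<in>Y. Cons u ` pverts (Tx x)) ((\<lambda>x. [u, x]) ` Y)) (weight tree_label)"
  using assms(2-)
\<comment> \<open>The rule inserts a new minimum \<open>y\<close>. Since \<open>insert y A\<close>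
  is upward closed in \<open>N\<close>, the neighbours already removed are exactly those below
  \<open>y\<close>.\<close>
proof (induction Y rule: finite_linorder_min_induct)
  case empty
  show ?case
    by (auto simp: pyramids_empty weight_equiv_def word_comm_class intro!: exI[of _ "\<lambda>_. word_class T []"])
next
  case (insert y A)
  have y: "y \<in> N" and A: "A \<subseteq> N" "y \<notin> A"
    using insert by auto
  have symT: "sym (parcs T)"
    unfolding T_def by (intro sym_parcs pair_graph_stable_path_tree G)
  let ?S = "pverts G - ({u} \<union> {z \<in> N. z < y})"
  have S: "pverts G - ({u} \<union> (N - insert y A)) = ?S"
  proof -
    have "N - insert y A = {z \<in> N. z < y}"
      using insert by (auto simp: not_less)
    then show ?thesis by simp
  qed
  let ?V = "\<lambda>Y. \<Union>x\<in>Y. Cons u ` pverts (Tx x)"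
  let ?R = "\<lambda>Y. (\<lambda>x. [u, x]) ` Y"
  have "\<forall>a\<in>A. \<forall>z\<in>N. a < z \<longrightarrow> z \<in> A"
    using insert by (metis insert_iff order.asym)
  then have "weight_equiv (pyramids G (pverts G - ({u} \<union> (N - A))) A) (weight id)
      (pyramids T (?V A) (?R A)) (weight tree_label)"
    using insert A by simp
  moreover have "pyramids G (?S - {y}) (insert y A) = pyramids G (pverts G - ({u} \<union> (N - A))) A"
  proof -
    have eq: "?S - {y} = pverts G - ({u} \<union> (N - A))"
      using S y A by blast
    show ?thesis
      unfolding eq by (rule pyramids_cong) (use y A in blast)
  qed
  \<comment> \<open>Deleting \<open>[u, y]\<close> leaves the rest of its subtree without an
    admissible top, so only the subtrees at \<open>A\<close> contribute.\<close>
  moreover have "pyramids T (?V (insert y A) - {[u, y]}) (?R (insert y A)) = pyramids T (?V A) (?R A)"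
  proof -
    have "pyramids T (?V (insert y A) - {[u, y]}) (?R (insert y A)) =
        pyramids T (?V A) (?R (insert y A))"
    proof (rule pyramids_restrict)
      show "?V A \<subseteq> ?V (insert y A) - {[u, y]}"
        using A subtree_vertex by fastforce
      show "?R (insert y A) \<inter> (?V (insert y A) - {[u, y]}) \<subseteq> ?V A"
        using subtree_root by auto
      fix a b assume ab: "a \<in> ?V A" "b \<in> ?V (insert y A) - {[u, y]}" "(b, a) \<in> parcs T"
      then obtain x where x: "x \<in> A" "a \<in> Cons u ` pverts (Tx x)"
        by blast
      have "b \<in> Cons u ` pverts (Tx x)"
        by (rule subtree_restrict[OF _ _ _ x(2) ab(2,3), of "insert y A"]) (use x y A in auto)
      then show "b \<in> ?V A" using x(1) by blast
    qed
    also have "\<dots> = pyramids T (?V A) (?R A)"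
      using A subtree_vertex by (intro pyramids_cong) fastforce
    finally show ?thesis .
  qed
  \<comment> \<open>Words topped by \<open>y\<close> stay inside the branch at \<open>y\<close>, and
    those topped by \<open>[u, y]\<close> inside the corresponding subtree; \<open>IH\<close>
    compares the two.\<close>
  moreover have "weight_equiv (pyramids G ?S {y}) (weight id)
      (pyramids T (?V (insert y A)) {[u, y]}) (weight tree_label)"
  proof -
    have "pyramids T (?V (insert y A)) {[u, y]} = pyramids T (Cons u ` pverts (Tx y)) {[u, y]}"
    proof (rule pyramids_restrict)
      fix a b
      assume ab: "a \<in> Cons u ` pverts (Tx y)" "b \<in> ?V (insert y A)" "(b, a) \<in> parcs T"
      show "b \<in> Cons u ` pverts (Tx y)"
        by (rule subtree_restrict[OF _ _ _ ab, of "insert y A"]) (use y A in auto)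
    qed (use subtree_root in auto)
    moreover have "weight_equiv (words_at (branch G u y) y) (weight id) (pyramids G ?S {y}) (weight id)"
      using branch_weight_equiv[OF G y[unfolded N_def], of id] by (simp only: N_def)
    ultimately show ?thesis
      using weight_equiv_trans[OF weight_equiv_trans[OF weight_equiv_sym IH[OF y]]
          subtree_weight_equiv[OF y]] by simp
  qed
  ultimately have prod: "weight_equiv (pyramids G ?S {y} \<times> pyramids G (?S - {y}) (insert y A))
      (\<lambda>(w, z). weight id w + weight id z)
      (pyramids T (?V (insert y A)) {[u, y]} \<times>
        pyramids T (?V (insert y A) - {[u, y]}) (?R (insert y A)))
      (\<lambda>(w, z). weight tree_label w + weight tree_label z)"
    by (intro weight_equiv_prod) simp_all
  have split_G: "weight_equiv (pyramids G ?S {y} \<times> pyramids G (?S - {y}) (insert y A))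
      (\<lambda>(w, z). weight id w + weight id z) (pyramids G ?S (insert y A)) (weight id)"
    by (rule pyramids_split[OF sym_parcs[OF G]]) auto
  have split_T: "weight_equiv (pyramids T (?V (insert y A)) {[u, y]} \<times>
        pyramids T (?V (insert y A) - {[u, y]}) (?R (insert y A)))
      (\<lambda>(w, z). weight tree_label w + weight tree_label z)
      (pyramids T (?V (insert y A)) (?R (insert y A))) (weight tree_label)"
    by (rule pyramids_split[OF symT]) (use y A in \<open>auto simp: pverts_tree\<close>)
  show ?case
    unfolding S
    by (rule weight_equiv_trans[OF weight_equiv_trans[OF weight_equiv_sym[OF split_G] prod] split_T])
qed

lemma words_at_tree_step:
  assumes "\<And>x. x \<in> N \<Longrightarrow> weight_equiv (words_at (branch G u x) x) (weight id)
      (words_at (Tx x) [x]) (weight tree_label)"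
  shows "weight_equiv (words_at G u) (weight id) (words_at T [u]) (weight tree_label)"
proof (rule words_at_weight_equiv)
  have "N \<subseteq> pverts G"
    using neighbours_subset[OF G] by (auto simp: N_def)
  then have "finite N"
    using G pair_fin_digraph.pair_finite_verts[of G]
    by (auto simp: pair_graph_def pair_digraph_def intro: finite_subset)
  \<comment> \<open>For \<open>Y = N\<close> only \<open>u\<close> is removed from \<open>G\<close>,
    and all of the tree except its root remains.\<close>
  then have "weight_equiv (pyramids G (pverts G - ({u} \<union> (N - N))) N) (weight id)
    (pyramids T (\<Union>x\<in>N. Cons u ` pverts (Tx x)) ((\<lambda>x. [u, x]) ` N)) (weight tree_label)"
    by (intro branches_weight_equiv assms) auto
  then show "weight_equiv (pyramids G (pverts G - {u}) (neighbours G u)) (weight id)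
      (pyramids T (pverts T - {[u]}) (neighbours T [u])) (weight tree_label)"
    by (simp add: pverts_tree_minus_root neighbours_tree_root flip: N_def)
  show "sym (parcs T)"
    unfolding T_def by (intro sym_parcs pair_graph_stable_path_tree G)
qed (use u sym_parcs[OF G] in \<open>auto simp: pverts_tree tree_label_def\<close>)

end

section \<open>Induction along the tree and the final bijection\<close>

lemma words_at_stable_path_tree:
  assumes "pair_graph G" "u \<in> pverts G"
  shows "weight_equiv (words_at G u) (weight id)
    (words_at (stable_path_tree G u) [u]) (weight tree_label)"
  using assms
proof (induction G u rule: stable_path_tree.induct)
  case (1 G u)
  have "finite (pverts G)"
    using "1.prems"(1) pair_fin_digraph.pair_finite_verts[of G]
    by (simp add: pair_graph_def pair_digraph_def)
  with "1.prems"(2) have total: "finite (pverts G) \<and> u \<in> pverts G"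
    by simp
  show ?case
  proof (rule words_at_tree_step[OF "1.prems"])
    fix x assume "x \<in> neighbours G u"
    note B = branch_props[OF "1.prems"(1) this]
    show "weight_equiv (words_at (branch G u x) x) (weight id)
        (words_at (stable_path_tree (branch G u x) x) [x]) (weight tree_label)"
      by (rule "1.IH"[OF total \<open>x \<in> neighbours G u\<close> B])
  qed
qed

lemma word_length_words_at: "w \<in> words_at H x \<Longrightarrow> word_length w = size (word_comm w)"
proof -
  assume "w \<in> words_at H x"
  then obtain xs where "xs \<in> lists (pverts H)" "w = word_class H xs"
    unfolding words_at_def word_monoid_carrier word_monoid_one by blast
  then show ?thesis by (simp add: word_length_class word_comm_class)
qed

theorem theorem3p1:
  fixes G :: "'a::linorder pair_pre_digraph" and u :: 'a
  assumes "pair_graph G" and "connected (with_proj G)" and "u \<in> pverts G"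
  shows "\<exists>\<phi>. bij_betw \<phi> (words_at G u) (words_at (stable_path_tree G u) (tree_root u)) \<and>
    (\<forall>w \<in> words_at G u. word_length (\<phi> w) = word_length w) \<and>
    (\<forall>w \<in> words_at G u. image_mset tree_label (word_comm (\<phi> w)) = word_comm w)"
proof -
  let ?T = "stable_path_tree G u"
  obtain \<phi> where bij: "bij_betw \<phi> (words_at G u) (words_at ?T (tree_root u))"
    and wt: "\<forall>w\<in>words_at G u. weight tree_label (\<phi> w) = word_comm w"
    using words_at_stable_path_tree[OF assms(1,3)]
    unfolding weight_equiv_def tree_root_def by auto
  have "word_length (\<phi> w) = word_length w" if "w \<in> words_at G u" for w
  proof -
    have "word_length (\<phi> w) = size (word_comm (\<phi> w))"
      by (rule word_length_words_at[OF bspec[OF bij_betwE[OF bij] that]])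
    also have "\<dots> = size (weight tree_label (\<phi> w))"
      by simp
    also have "\<dots> = word_length w"
      using wt that word_length_words_at[OF that] by simp
    finally show ?thesis .
  qed
  with bij wt show ?thesis by blast
qed

end
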